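(* There is a positive constant $c_1$ such that the following holds. Let $n$ be a positive integer, let $\mathcal A\subseteq \mathcal P([n])$ be a counterexample to the union-closed conjecture, let $\mathcal B=\mathcal P([n])\setminus \mathcal A$, and let $m=|\mathcal B|$. Then \[ \|\mathcal I(m)\| > m\left(\frac n2-1+c_1\right). \]
   Context: $[n]=\{1,\dots,n\}$ and $\mathcal P([n])$ is its power set. A family $\mathcal A$ of sets is union-closed if $A\cup B\in\mathcal A$ whenever $A,B\in\mathcal A$. For a family $\mathcal A$ and an integer $i$, $\deg_{\mathcal A}(i)=|\{A\in\mathcal A: i\in A\}|$. A counterexample to the union-closed conjecture is a union-closed family $\mathcal A\neq\{\emptyset\}$ such that $\deg_{\mathcal A}(i)<|\mathcal A|/2$ for every positive integer $i$. For a finite family $\mathcal F$ of finite sets, $\|\mathcal F\|=\sum_{F\in\mathcal F}|F|$. The colex order on finite sets of positive integers is defined by $A<B$ iff $\max(A\triangle B)\in B$; $\mathcal I(m)$ denotes the family of the first $m$ sets in this order (e.g. $\mathcal I(9)=\{\emptyset,\{1\},\{2\},\{1,2\},\{3\},\{1,3\},\{2,3\},\{1,2,3\},\{4\}\}$). *)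

theory Defs
  imports Complex_Main "HOL-Library.FuncSet" "HOL-Library.Nat_Bijection"
begin

definition union_closed :: "'a set set \<Rightarrow> bool" where
  "union_closed \<A> \<longleftrightarrow> (\<forall>A\<in>\<A>. \<forall>B\<in>\<A>. A \<union> B \<in> \<A>)"

definition family_degree :: "'a set set \<Rightarrow> 'a \<Rightarrow> nat" where
  "family_degree \<A> i = card {A \<in> \<A>. i \<in> A}"

(* The empty family and, since card is 0 on infinite sets, every infinite family
   fail the strict inequality at i = 1. *)
definition union_closed_counterexample :: "nat set set \<Rightarrow> bool" where
  "union_closed_counterexample \<A> \<longleftrightarrow>
     union_closed \<A> \<and> \<A> \<noteq> {{}} \<and>
     (\<forall>i>0. real (family_degree \<A> i) < real (card \<A>) / 2)"

definition family_norm :: "'a set set \<Rightarrow> nat" where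
  "family_norm \<F> = (\<Sum>F\<in>\<F>. card F)"

(* The conjunct A \<noteq> B is needed because Max {} is an unspecified number. *)
definition colex_less :: "nat set \<Rightarrow> nat set \<Rightarrow> bool" where
  "colex_less A B \<longleftrightarrow> A \<noteq> B \<and> Max (sym_diff A B) \<in> B"

definition pos_finite_sets :: "nat set set" where
  "pos_finite_sets = {A. finite A \<and> 0 \<notin> A}"

(* The first m sets are those with fewer than m predecessors. Predecessor sets are
   finite (finite_colex_predecessors), so card counts them correctly, and the family
   does have m members (card_colex_initial). *)
definition colex_initial :: "nat \<Rightarrow> nat set set" where
  "colex_initial m =
     {A \<in> pos_finite_sets. card {B \<in> pos_finite_sets. colex_less B A} < m}"

lemma colex_less_imp_set_encode_less:
  assumes "finite A" "finite B" "colex_less A B"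
  shows "set_encode A < set_encode B"
proof -
  define M where "M = Max (sym_diff A B)"
  have fin: "finite (sym_diff A B)" and ne: "sym_diff A B \<noteq> {}"
    using assms by (auto simp: colex_less_def)
  have MB: "M \<in> B" using assms by (simp add: colex_less_def M_def)
  have MA: "M \<notin> A" using Max_in[OF fin ne] MB by (auto simp: M_def)
  have above: "x \<in> A \<longleftrightarrow> x \<in> B" if "x > M" for x
    using Max_ge[OF fin, of x] that by (force simp: M_def)
  have "set_encode A = set_encode (A \<inter> {..<M}) + set_encode (A \<inter> {M<..})"
    unfolding set_encode_def using assms MA
    by (subst sum.union_disjoint[symmetric])
       (auto intro!: sum.cong, metis linorder_neqE_nat)
  moreover have "set_encode (A \<inter> {..<M}) < 2 ^ M"
  proof -
    have "set_encode (A \<inter> {..<M}) \<le> (\<Sum>i<M. 2 ^ i)"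
      unfolding set_encode_def by (rule sum_mono2) auto
    also have "\<dots> < 2 ^ M" by (induction M) auto
    finally show ?thesis .
  qed
  moreover have "A \<inter> {M<..} = B \<inter> {M<..}" using above by auto
  moreover have "2 ^ M + set_encode (B \<inter> {M<..}) \<le> set_encode B"
  proof -
    have "2 ^ M + set_encode (B \<inter> {M<..}) = set_encode (insert M (B \<inter> {M<..}))"
      using assms by simp
    also have "\<dots> \<le> set_encode B"
      unfolding set_encode_def using assms MB by (intro sum_mono2) auto
    finally show ?thesis .
  qed
  ultimately show ?thesis by simp
qed

lemma colex_less_total:
  assumes "finite A" "finite B" "A \<noteq> B"
  shows "colex_less A B \<or> colex_less B A"
proof -
  have "Max (sym_diff A B) \<in> sym_diff A B"
    using assms by (intro Max_in) auto
  then show ?thesis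
    using assms unfolding colex_less_def by (auto simp: Un_commute)
qed

lemma colex_less_iff_set_encode:
  assumes "finite A" "finite B"
  shows "colex_less A B \<longleftrightarrow> set_encode A < set_encode B"
  using assms colex_less_imp_set_encode_less colex_less_total
  by (metis less_irrefl less_asym)

lemma bij_betw_pos_finite_sets:
  "bij_betw (\<lambda>A. set_encode A div 2) {A \<in> pos_finite_sets. set_encode A < 2 * k} {..<k}"
proof (rule bij_betwI[where g = "\<lambda>j. set_decode (2 * j)"])
  show "(\<lambda>j. set_decode (2 * j))
      \<in> {..<k} \<rightarrow> {A \<in> pos_finite_sets. set_encode A < 2 * k}"
    by (auto simp: pos_finite_sets_def)
next
  fix A assume "A \<in> {A \<in> pos_finite_sets. set_encode A < 2 * k}"
  then show "set_decode (2 * (set_encode A div 2)) = A"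
    by (auto simp: pos_finite_sets_def even_set_encode_iff)
qed auto

lemma colex_predecessors_eq:
  assumes "A \<in> pos_finite_sets"
  shows "{B \<in> pos_finite_sets. colex_less B A} =
    {B \<in> pos_finite_sets. set_encode B < 2 * (set_encode A div 2)}"
  using assms by (auto simp: pos_finite_sets_def colex_less_iff_set_encode even_set_encode_iff)

lemma finite_colex_predecessors:
  "A \<in> pos_finite_sets \<Longrightarrow> finite {B \<in> pos_finite_sets. colex_less B A}"
  using bij_betw_finite[OF bij_betw_pos_finite_sets]
  by (simp add: colex_predecessors_eq)

lemma colex_initial_eq:
  "colex_initial m = {A \<in> pos_finite_sets. set_encode A < 2 * m}"
proof -
  have "card {B \<in> pos_finite_sets. colex_less B A} = set_encode A div 2"
    if "A \<in> pos_finite_sets" for A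
    using bij_betw_same_card[OF bij_betw_pos_finite_sets, of "set_encode A div 2"] that
    by (simp add: colex_predecessors_eq)
  then show ?thesis unfolding colex_initial_def by (auto simp: less_mult_imp_div_less)
qed

lemma card_colex_initial: "card (colex_initial m) = m"
  using bij_betw_same_card[OF bij_betw_pos_finite_sets, of m]
  by (simp add: colex_initial_eq)

lemma finite_colex_initial: "finite (colex_initial m)"
  using bij_betw_finite[OF bij_betw_pos_finite_sets, of m]
  by (simp add: colex_initial_eq)

lemma colex_initial_9:
  "colex_initial 9 = {{}, {1}, {2}, {1,2}, {3}, {1,3}, {2,3}, {1,2,3}, {4}}"
proof (rule card_subset_eq[symmetric])
  let ?F = "{{}, {1}, {2}, {1,2}, {3}, {1,3}, {2,3}, {1,2,3}, {4}} :: nat set set"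
  show "?F \<subseteq> colex_initial 9"
    by (simp add: colex_initial_eq pos_finite_sets_def)
  have "card (set_encode ` ?F) \<le> card ?F"
    by (rule card_image_le) simp
  moreover have "set_encode ` ?F = {0, 2, 4, 6, 8, 10, 12, 14, 16}"
    by simp
  moreover have "card ?F \<le> card (colex_initial 9)"
    using \<open>?F \<subseteq> colex_initial 9\<close> by (rule card_mono[OF finite_colex_initial])
  ultimately show "card ?F = card (colex_initial 9)"
    by (simp add: card_colex_initial)
qed (rule finite_colex_initial)

end

theory Submission
  imports Defs
begin

text \<open>
  Since \<open>\<A>\<close> is union-closed, a set outside \<open>\<A>\<close> covers at most one member of \<open>\<A>\<close>; so at
  most \<open>m\<close> edges of the cube lead upwards from \<open>\<A>\<close> to \<open>\<B>\<close>. For the indicator of \<open>\<B>\<close>, this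
  bounds twice the total influence plus the sum of the level-one Fourier coefficients by \<open>2x\<close>, where
  \<open>x = m/2\<^sup>n\<close>. In a counterexample these coefficients lie between \<open>0\<close> and \<open>1/2\<close>, hence
  their squares are controlled by the coefficients themselves. The Fourier inequality ``twice the variance is at most the influence plus
  the level-one weight'' then gives \<open>4x(1 - x) \<le> 2x\<close>, that is, \<open>2m \<ge> 2\<^sup>n\<close>; this is
  an argument of Karpas. For such \<open>m\<close> the bound on \<open>\<parallel>\<I>(m)\<parallel>\<close>, which is the sum of the binary
  digit sums of \<open>0, \<dots>, m - 1\<close>, holds with room to spare.
\<close>

section \<open>An influence inequality on the discrete cube\<close>

definition cube_mean :: "'a set \<Rightarrow> ('a set \<Rightarrow> real) \<Rightarrow> real" where
  "cube_mean S g = (\<Sum>A\<in>Pow S. g A) / 2 ^ card S"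

text \<open>With the factor 1/2, the mean is the Fourier coefficient of the character that is 1 on
  sets containing \<open>i\<close> and -1 on the others; the mean square is the influence of
  \<open>i\<close>.\<close>

definition cube_deriv :: "'a \<Rightarrow> ('a set \<Rightarrow> real) \<Rightarrow> 'a set \<Rightarrow> real" where
  "cube_deriv i g A = (g (insert i A) - g (A - {i})) / 2"

lemma sum_Pow_insert:
  assumes "finite S" "i \<notin> S"
  shows "(\<Sum>A\<in>Pow (insert i S). h A) = (\<Sum>A\<in>Pow S. h A + h (insert i A) :: 'b::comm_monoid_add)"
proof -
  have "inj_on (insert i) (Pow S)"
    using assms(2) by (auto simp: inj_on_def)
  moreover have "Pow S \<inter> insert i ` Pow S = {}"
    using assms(2) by auto
  ultimately show ?thesis
    using assms(1)
    by (simp add: Pow_insert sum.union_disjoint sum.reindex sum.distrib)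
qed

lemma cube_mean_insert:
  assumes "finite S" "i \<notin> S"
  shows "cube_mean (insert i S) h = cube_mean S (\<lambda>A. (h A + h (insert i A)) / 2)"
  using assms by (simp add: cube_mean_def sum_Pow_insert sum_divide_distrib[symmetric])

lemma cube_mean_cong:
  "(\<And>A. A \<subseteq> S \<Longrightarrow> g A = h A) \<Longrightarrow> cube_mean S g = cube_mean S h"
  by (simp add: cube_mean_def)

lemma cube_mean_add: "cube_mean S (\<lambda>A. g A + h A) = cube_mean S g + cube_mean S h"
  by (simp add: cube_mean_def sum.distrib add_divide_distrib)

lemma cube_mean_cmult: "cube_mean S (\<lambda>A. c * g A) = c * cube_mean S g"
  by (simp add: cube_mean_def sum_distrib_left[symmetric])

lemma cube_mean_mono:
  "(\<And>A. A \<subseteq> S \<Longrightarrow> g A \<le> h A) \<Longrightarrow> cube_mean S g \<le> cube_mean S h"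
  by (auto simp: cube_mean_def intro!: divide_right_mono sum_mono)

lemma cube_mean_const: "finite S \<Longrightarrow> cube_mean S (\<lambda>A. c) = c"
  by (simp add: cube_mean_def card_Pow)

lemma cube_mean_sum: "cube_mean S (\<lambda>A. \<Sum>i\<in>T. h i A) = (\<Sum>i\<in>T. cube_mean S (h i))"
  by (simp add: cube_mean_def sum.swap[of _ T] sum_divide_distrib)

section \<open>Even and odd parts \<open>u\<close> and \<open>v\<close> of a function in one
  coordinate\<close>

context
  fixes S :: "'a set" and k :: 'a and g u v :: "'a set \<Rightarrow> real"
  assumes S: "finite S" "k \<notin> S"
  defines "u \<equiv> \<lambda>A. (g A + g (insert k A)) / 2"
    and "v \<equiv> \<lambda>A. (g (insert k A) - g A) / 2"
begin

lemma split_mean: "cube_mean (insert k S) g = cube_mean S u"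
  using S by (simp add: cube_mean_insert u_def)

text \<open>Without \<open>k\<close> the function is \<open>u - v\<close>, with \<open>k\<close> it
  is \<open>u + v\<close>, so the cross terms cancel on averaging.\<close>

lemma split_mean_square:
  "cube_mean (insert k S) (\<lambda>A. (g A)\<^sup>2) =
    cube_mean S (\<lambda>A. (u A)\<^sup>2) + cube_mean S (\<lambda>A. (v A)\<^sup>2)"
  unfolding cube_mean_add[symmetric] cube_mean_insert[OF S]
  by (rule cube_mean_cong) (simp add: u_def v_def power2_eq_square field_simps)

lemma split_deriv_new:
  "cube_mean (insert k S) (cube_deriv k g) = cube_mean S v"
  "cube_mean (insert k S) (\<lambda>A. (cube_deriv k g A)\<^sup>2) = cube_mean S (\<lambda>A. (v A)\<^sup>2)"
proof -
  have "A - {k} = A" if "A \<subseteq> S" for A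
    using that S by auto
  then show
    "cube_mean (insert k S) (cube_deriv k g) = cube_mean S v"
    "cube_mean (insert k S) (\<lambda>A. (cube_deriv k g A)\<^sup>2) = cube_mean S (\<lambda>A. (v A)\<^sup>2)"
    using S by (auto simp: cube_mean_insert cube_deriv_def v_def intro!: cube_mean_cong)
qed

text \<open>Differentiation in \<open>i\<close> respects the splitting along \<open>k\<close>.
  Averaging over \<open>k\<close> cancels the part of \<open>v\<close> in the mean and the cross
  terms in the mean square.\<close>

lemma split_deriv_old:
  assumes "i \<in> S"
  shows "cube_mean (insert k S) (cube_deriv i g) = cube_mean S (cube_deriv i u)"
    and "cube_mean (insert k S) (\<lambda>A. (cube_deriv i g A)\<^sup>2) =
      cube_mean S (\<lambda>A. (cube_deriv i u A)\<^sup>2) + cube_mean S (\<lambda>A. (cube_deriv i v A)\<^sup>2)"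
proof -
  have eq: "insert i (insert k A) = insert k (insert i A)"
    "insert k A - {i} = insert k (A - {i})" for A
    using assms S by auto
  show "cube_mean (insert k S) (cube_deriv i g) = cube_mean S (cube_deriv i u)"
    unfolding cube_mean_insert[OF S]
    by (rule cube_mean_cong) (simp add: cube_deriv_def u_def eq field_simps)
  show "cube_mean (insert k S) (\<lambda>A. (cube_deriv i g A)\<^sup>2) =
      cube_mean S (\<lambda>A. (cube_deriv i u A)\<^sup>2) + cube_mean S (\<lambda>A. (cube_deriv i v A)\<^sup>2)"
    unfolding cube_mean_add[symmetric] cube_mean_insert[OF S]
    by (rule cube_mean_cong)
      (simp add: cube_deriv_def u_def v_def eq power2_eq_square field_simps)
qed

end

text \<open>A squared Fourier coefficient at a nonempty set counts once on the left and as often as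
  the set has elements on the right. In the induction, the mean square of the odd part is added to
  both sides, and its nonnegative influence is discarded.\<close>

lemma cube_poincare:
  assumes "finite S"
  shows "cube_mean S (\<lambda>A. (g A)\<^sup>2) - (cube_mean S g)\<^sup>2
    \<le> (\<Sum>i\<in>S. cube_mean S (\<lambda>A. (cube_deriv i g A)\<^sup>2))"
  using assms
proof (induction S arbitrary: g rule: finite_induct)
  case empty
  then show ?case by (simp add: cube_mean_def)
next
  case (insert k S)
  note split = split_mean[OF insert(1,2), of g] split_mean_square[OF insert(1,2), of g]
    split_deriv_new[OF insert(1,2), of g] split_deriv_old[OF insert(1,2), of _ g]
  have "0 \<le> (\<Sum>i\<in>S. cube_mean S (\<lambda>A. (cube_deriv i (\<lambda>A. (g (insert k A) - g A) / 2) A)\<^sup>2))"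
    by (simp add: cube_mean_def sum_nonneg)
  with insert.IH[of "\<lambda>A. (g A + g (insert k A)) / 2"] show ?case
    using insert(1,2) by (simp add: split sum.distrib)
qed

text \<open>
  With Fourier coefficients \<open>c\<^sub>S\<close> this reads \<open>\<Sum>\<^bsub>|S| \<ge> 1\<^esub> 2c\<^sub>S\<^sup>2 \<le> \<Sum>\<^sub>S |S| c\<^sub>S\<^sup>2 + \<Sum>\<^bsub>|S| = 1\<^esub> c\<^sub>S\<^sup>2\<close>.
\<close>

lemma two_variance_le_influence_plus_level_one:
  assumes "finite S"
  shows "2 * (cube_mean S (\<lambda>A. (g A)\<^sup>2) - (cube_mean S g)\<^sup>2)
    \<le> (\<Sum>i\<in>S. cube_mean S (\<lambda>A. (cube_deriv i g A)\<^sup>2))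
      + (\<Sum>i\<in>S. (cube_mean S (cube_deriv i g))\<^sup>2)"
  using assms
proof (induction S arbitrary: g rule: finite_induct)
  case empty
  then show ?case by (simp add: cube_mean_def)
next
  case (insert k S)
  note split = split_mean[OF insert(1,2), of g] split_mean_square[OF insert(1,2), of g]
    split_deriv_new[OF insert(1,2), of g] split_deriv_old[OF insert(1,2), of _ g]
  \<comment> \<open>Beyond the hypothesis for the even part, twice the mean square of the odd part
    \<open>v\<close> must be bounded by its mean square, its squared mean and its influence. This is
    the Poincare inequality for \<open>v\<close>.\<close>
  show ?case
    using insert.IH[of "\<lambda>A. (g A + g (insert k A)) / 2"] insert(1,2)
      cube_poincare[OF insert(1), of "\<lambda>A. (g (insert k A) - g A) / 2"]
    by (simp add: split sum.distrib)
qed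

section \<open>The complement of a counterexample is large\<close>

text \<open>Two distinct members of the form \<open>B - {i}\<close> and \<open>B - {j}\<close> would
  have union \<open>B\<close>.\<close>

lemma card_covered_members_le_1:
  assumes "union_closed \<A>" "B \<notin> \<A>"
  shows "card {i \<in> B. B - {i} \<in> \<A>} \<le> 1"
proof -
  have "i = j" if "i \<in> B" "B - {i} \<in> \<A>" "j \<in> B" "B - {j} \<in> \<A>" for i j
  proof (rule ccontr)
    assume "i \<noteq> j"
    then have "(B - {i}) \<union> (B - {j}) = B" using that by auto
    then show False
      using assms that unfolding union_closed_def by metis
  qed
  then show ?thesis
    by (metis (no_types, lifting) One_nat_def card_le_Suc0_iff_eq card.infinite mem_Collect_eq
        zero_le)
qed

lemma counterexample_complement_large:
  fixes S :: "'a set"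
  assumes fin: "finite S" and sub: "\<A> \<subseteq> Pow S" and uc: "union_closed \<A>"
    and deg: "\<And>i. i \<in> S \<Longrightarrow> real (family_degree \<A> i) \<le> real (card \<A>) / 2"
    and ne: "\<A> \<noteq> Pow S"
  shows "2 ^ card S \<le> 2 * card (Pow S - \<A>)"
proof -
  define g where "g A = (if A \<in> \<A> then 0 else 1 :: real)" for A
  define m where "m = card (Pow S - \<A>)"
  define x where "x = real m / 2 ^ card S"
  have fin_Pow: "finite (Pow S)" using fin by simp
  have mean_g: "cube_mean S g = x"
  proof -
    have "(\<Sum>A\<in>Pow S. g A) = (\<Sum>A\<in>Pow S - \<A>. 1)"
      using fin_Pow by (intro sum.mono_neutral_cong_right) (auto simp: g_def)
    then show ?thesis by (simp add: cube_mean_def x_def m_def)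
  qed
  have mean_g_square: "cube_mean S (\<lambda>A. (g A)\<^sup>2) = x"
    unfolding mean_g[symmetric] by (rule cube_mean_cong) (simp add: g_def)

  \<comment> \<open>Pairing \<open>A\<close> with \<open>insert i A\<close> turns the degree bound
    into an excess of nonmembers containing \<open>i\<close> over nonmembers avoiding it. The upper
    bound holds pointwise.\<close>
  have mean_deriv: "0 \<le> cube_mean S (cube_deriv i g)" "cube_mean S (cube_deriv i g) \<le> 1 / 2"
    if i: "i \<in> S" for i
  proof -
    define T where "T = S - {i}"
    have T: "finite T" "i \<notin> T" "S = insert i T" using fin i by (auto simp: T_def)
    have "family_degree \<A> i = (\<Sum>A\<in>Pow S. if A \<in> \<A> \<and> i \<in> A then 1 else 0)"
      unfolding family_degree_def card_eq_sum using sub fin_Pow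
      by (intro sum.mono_neutral_cong_left) auto
    also have "\<dots> = (\<Sum>A\<in>Pow T. if insert i A \<in> \<A> then 1 else 0)"
      unfolding T(3) sum_Pow_insert[OF T(1,2)] using T by (intro sum.cong) auto
    finally have "real (family_degree \<A> i) = (\<Sum>A\<in>Pow T. 1 - g (insert i A))"
      by (simp add: g_def if_distrib cong: if_cong)
    moreover have "card \<A> = (\<Sum>A\<in>Pow S. if A \<in> \<A> then 1 else 0)"
      unfolding card_eq_sum using sub fin_Pow
      by (intro sum.mono_neutral_cong_left) auto
    then have "card \<A> = (\<Sum>A\<in>Pow T. (if A \<in> \<A> then 1 else 0)
        + (if insert i A \<in> \<A> then 1 else 0))"
      unfolding T(3) sum_Pow_insert[OF T(1,2)] .
    then have "real (card \<A>) = (\<Sum>A\<in>Pow T. (1 - g A) + (1 - g (insert i A)))"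
      by (simp only: of_nat_sum) (intro sum.cong, auto simp: g_def)
    ultimately have "0 \<le> (\<Sum>A\<in>Pow T. g (insert i A) - g A)"
      using deg[OF i] by (simp add: sum.distrib sum_subtractf sum_negf)
    moreover have "cube_mean S (cube_deriv i g)
        = (\<Sum>A\<in>Pow T. g (insert i A) - g A) / 2 / 2 ^ card T"
      unfolding T(3) split_deriv_new(1)[OF T(1,2)]
      by (simp add: cube_mean_def sum_divide_distrib)
    ultimately show "0 \<le> cube_mean S (cube_deriv i g)" by simp
    have "cube_mean S (cube_deriv i g) \<le> cube_mean S (\<lambda>A. 1 / 2)"
      by (rule cube_mean_mono) (simp add: cube_deriv_def g_def)
    then show "cube_mean S (cube_deriv i g) \<le> 1 / 2"
      using fin by (simp add: cube_mean_const)
  qed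

  \<comment> \<open>The derivative takes the values -1/2, 0 and 1/2, and
    \<open>2 * t\<^sup>2 + t\<close> is 0, 0 and 1 there: it detects exactly the edges leading up
    out of \<open>\<A>\<close>.\<close>
  have up_edges: "(\<Sum>i\<in>S. cube_mean S (\<lambda>A. 2 * (cube_deriv i g A)\<^sup>2 + cube_deriv i g A)) \<le> 2 * x"
  proof -
    \<comment> \<open>\<open>e\<close> marks both ends of such an edge and \<open>d\<close> only its
      upper end, whence the factor 2. At a fixed upper end there is at most one edge.\<close>
    define e where "e i A = (if insert i A \<notin> \<A> \<and> A - {i} \<in> \<A> then 1 else 0 :: real)" for i A
    define d where "d i A = (if i \<in> A \<and> A \<notin> \<A> \<and> A - {i} \<in> \<A> then 1 else 0 :: real)" for i A
    have "cube_mean S (\<lambda>A. 2 * (cube_deriv i g A)\<^sup>2 + cube_deriv i g A) = cube_mean S (\<lambda>A. 2 * d i A)"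
      if i: "i \<in> S" for i
    proof -
      have "cube_mean S (\<lambda>A. 2 * (cube_deriv i g A)\<^sup>2 + cube_deriv i g A) = cube_mean S (e i)"
        by (rule cube_mean_cong) (auto simp: cube_deriv_def g_def e_def power2_eq_square)
      also have "\<dots> = cube_mean S (\<lambda>A. 2 * d i A)"
      proof -
        have *: "S = insert i (S - {i})" "finite (S - {i})" "i \<notin> S - {i}" using i fin by auto
        have "A - {i} = A" if "A \<subseteq> S - {i}" for A using that by auto
        then show ?thesis
          by (subst (1 2) *(1), unfold cube_mean_insert[OF *(2,3)], intro cube_mean_cong)
            (auto simp: e_def d_def)
      qed
      finally show ?thesis .
    qed
    then have "(\<Sum>i\<in>S. cube_mean S (\<lambda>A. 2 * (cube_deriv i g A)\<^sup>2 + cube_deriv i g A))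
        = cube_mean S (\<lambda>A. 2 * (\<Sum>i\<in>S. d i A))"
      by (simp add: cube_mean_sum sum_distrib_left)
    also have "\<dots> \<le> cube_mean S (\<lambda>A. 2 * g A)"
    proof (rule cube_mean_mono)
      fix A assume A: "A \<subseteq> S"
      have "(\<Sum>i\<in>S. d i A) = (\<Sum>i\<in>{i \<in> A. A \<notin> \<A> \<and> A - {i} \<in> \<A>}. 1)"
        using A fin by (intro sum.mono_neutral_cong_right) (auto simp: d_def)
      also have "\<dots> \<le> g A"
        using card_covered_members_le_1[OF uc, of A] by (cases "A \<in> \<A>") (auto simp: g_def)
      finally show "2 * (\<Sum>i\<in>S. d i A) \<le> 2 * g A" by simp
    qed
    also have "\<dots> = 2 * x" by (simp add: cube_mean_cmult mean_g)
    finally show ?thesis .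
  qed

  \<comment> \<open>The inequality is doubled so that, once each \<open>2 * c\<^sup>2\<close> is
    replaced by \<open>c\<close> for the level-one coefficients, the right side is the sum bounded
    in \<open>up_edges\<close>.\<close>
  have "4 * (x - x\<^sup>2) \<le> 2 * (\<Sum>i\<in>S. cube_mean S (\<lambda>A. (cube_deriv i g A)\<^sup>2))
      + (\<Sum>i\<in>S. 2 * (cube_mean S (cube_deriv i g))\<^sup>2)"
    using two_variance_le_influence_plus_level_one[OF fin, of g]
    by (simp add: mean_g mean_g_square sum_distrib_left[symmetric])
  also have "(\<Sum>i\<in>S. 2 * (cube_mean S (cube_deriv i g))\<^sup>2) \<le> (\<Sum>i\<in>S. cube_mean S (cube_deriv i g))"
  proof (rule sum_mono)
    fix i assume "i \<in> S"
    from mean_deriv[OF this] show "2 * (cube_mean S (cube_deriv i g))\<^sup>2 \<le> cube_mean S (cube_deriv i g)"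
      using mult_left_mono[of "2 * cube_mean S (cube_deriv i g)" 1 "cube_mean S (cube_deriv i g)"]
      by (simp add: power2_eq_square)
  qed
  finally have "4 * (x - x\<^sup>2) \<le> 2 * x"
    using up_edges by (simp add: cube_mean_add cube_mean_cmult sum.distrib sum_distrib_left)
  then have "x * (1 - 2 * x) \<le> 0" by (simp add: power2_eq_square algebra_simps)
  \<comment> \<open>Some subset of \<open>S\<close> is missing from \<open>\<A>\<close>, so the
    factor \<open>x\<close> can be cancelled.\<close>
  moreover have "0 < x"
    using sub ne fin_Pow by (auto simp: x_def m_def card_gt_0_iff)
  ultimately have "1 \<le> 2 * x" by (simp add: mult_le_0_iff)
  then have "(2 :: real) ^ card S \<le> 2 * real m" by (simp add: x_def field_simps)
  then have "real (2 ^ card S) \<le> real (2 * m)" by simp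
  then show ?thesis unfolding m_def by linarith
qed

section \<open>Binary digit sums\<close>

definition digit_sum :: "nat \<Rightarrow> nat" where
  "digit_sum j = card (set_decode j)"

lemma digit_sum_double: "digit_sum (2 * j) = digit_sum j"
proof -
  have "set_decode (2 * j) = Suc ` set_decode j"
  proof (intro set_eqI)
    fix a show "a \<in> set_decode (2 * j) \<longleftrightarrow> a \<in> Suc ` set_decode j"
      by (cases a) auto
  qed
  then show ?thesis by (simp add: digit_sum_def card_image)
qed

lemma digit_sum_add_power:
  assumes "j < 2 ^ k"
  shows "digit_sum (2 ^ k + j) = Suc (digit_sum j)"
proof -
  have "k \<notin> set_decode j" using assms by (simp add: set_decode_def)
  moreover from this have "set_encode (insert k (set_decode j)) = 2 ^ k + j" by simp
  then have "set_decode (2 ^ k + j) = insert k (set_decode j)"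
    by (metis finite_insert finite_set_decode set_encode_inverse)
  ultimately show ?thesis by (simp add: digit_sum_def)
qed

text \<open>Colex order is the order of the codes, and sets avoiding 0 have even codes. The set with
  code \<open>2 * j\<close> has as many elements as \<open>j\<close> has binary ones.\<close>

lemma family_norm_colex_initial: "family_norm (colex_initial m) = (\<Sum>j<m. digit_sum j)"
proof -
  have "bij_betw (\<lambda>j. set_decode (2 * j)) {..<m} (colex_initial m)"
    unfolding colex_initial_eq
  proof (rule bij_betwI[where g = "\<lambda>A. set_encode A div 2"])
    fix A assume "A \<in> {A \<in> pos_finite_sets. set_encode A < 2 * m}"
    then show "set_decode (2 * (set_encode A div 2)) = A"
      by (auto simp: pos_finite_sets_def even_set_encode_iff)
  qed (auto simp: pos_finite_sets_def)
  then have "family_norm (colex_initial m) = (\<Sum>j<m. card (set_decode (2 * j)))"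
    unfolding family_norm_def by (simp add: sum.reindex_bij_betw[symmetric])
  then show ?thesis by (simp add: digit_sum_def[symmetric] digit_sum_double)
qed

text \<open>Each of the last \<open>s\<close> numbers has a leading one above the digits of a number
  below \<open>s\<close>.\<close>

lemma sum_digit_sum_add_power:
  assumes "s \<le> 2 ^ k"
  shows "(\<Sum>j<2 ^ k + s. digit_sum j) = (\<Sum>j<2 ^ k. digit_sum j) + s + (\<Sum>j<s. digit_sum j)"
  using assms by (induction s) (auto simp: digit_sum_add_power)

lemma sum_digit_sum_power: "2 * (\<Sum>j<2 ^ k. digit_sum j) = k * 2 ^ k"
proof (induction k)
  case (Suc k)
  then show ?case
    using sum_digit_sum_add_power[of "2 ^ k" k] by (simp add: mult_2[symmetric])
qed (simp add: digit_sum_def)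

text \<open>The average digit sum below \<open>2 ^ k\<close> is \<open>k / 2\<close>; an initial
  segment falls short of it by at most \<open>2 ^ k / 2\<close> in total. In the induction, the left
  side changes by \<open>r - 2 ^ k\<close> if \<open>r\<close> is at most \<open>2 ^ k\<close>;
  otherwise the leading ones leave a surplus \<open>s\<close>.\<close>

lemma sum_digit_sum_lower:
  assumes "r \<le> 2 ^ k"
  shows "real k * real r - 2 ^ k \<le> 2 * real (\<Sum>j<r. digit_sum j)"
  using assms
proof (induction k arbitrary: r)
  case 0
  have "- 1 \<le> (0 :: real)" by simp
  also have "0 \<le> 2 * real (\<Sum>j<r. digit_sum j)" by (simp del: of_nat_sum)
  finally show ?case by simp
next
  case (Suc k)
  show ?case
  proof (cases "r \<le> 2 ^ k")
    case True
    then have "real r \<le> 2 ^ k" by (metis of_nat_le_iff of_nat_numeral of_nat_power)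
    with Suc.IH[OF True] show ?thesis
      unfolding of_nat_Suc power_Suc by (simp only: ring_distribs)
  next
    case False
    then obtain s where s: "r = 2 ^ k + s" by (metis le_add_diff_inverse nat_le_linear)
    with Suc.prems have "s \<le> 2 ^ k" by simp
    have "2 * real (\<Sum>j<2 ^ k. digit_sum j) = real k * 2 ^ k"
      using arg_cong[OF sum_digit_sum_power[of k], of real] by simp
    moreover have "real r = 2 ^ k + real s" using s by simp
    ultimately show ?thesis
      using Suc.IH[OF \<open>s \<le> 2 ^ k\<close>] sum_digit_sum_add_power[OF \<open>s \<le> 2 ^ k\<close>]
      unfolding s by (simp add: algebra_simps)
  qed
qed

lemma sum_digit_sum_gt:
  assumes "2 ^ p \<le> m" "m \<le> 2 ^ Suc p"
  shows "real (\<Sum>j<m. digit_sum j) > real m * (real (Suc p) / 2 - 1 + 1 / 8)"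
proof -
  obtain s where s: "m = 2 ^ p + s" using assms(1) by (metis le_add_diff_inverse)
  then have "s \<le> 2 ^ p" using assms(2) by simp
  define N where "N = real (\<Sum>j<s. digit_sum j)"
  have m_real: "real m = 2 ^ p + real s" using s by simp
  have "2 * real (\<Sum>j<2 ^ p. digit_sum j) = real p * 2 ^ p"
    using arg_cong[OF sum_digit_sum_power[of p], of real] by simp
  then have sum_m: "2 * real (\<Sum>j<m. digit_sum j) = real p * 2 ^ p + 2 * real s + 2 * N"
    using sum_digit_sum_add_power[OF \<open>s \<le> 2 ^ p\<close>] unfolding s N_def by simp
  \<comment> \<open>This is twice the claim after subtracting \<open>(p - 1) * m\<close> from both
    sides; the right side is \<open>m / 4\<close>. The estimates below leave room for any constant
    less than 1/4 in place of 1/8.\<close>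
  have "2 ^ p + 2 * real s - (real p - 1) * real s + 2 * N > (2 ^ p + real s) / 4"
  \<comment> \<open>For small \<open>s\<close> the lower bound is applied with exponent
    \<open>p - 1\<close>, which loses only half of \<open>2 ^ p\<close>. For large \<open>s\<close>
    the exponent \<open>p\<close> suffices, as the left side is then at least
    \<open>3 * s\<close>.\<close>
  proof (cases "2 * s \<le> 2 ^ p")
    case True
    show ?thesis
    proof (cases p)
      case 0
      with True have "s = 0" by simp
      with 0 show ?thesis by (simp add: N_def)
    next
      case (Suc q)
      with True have "s \<le> 2 ^ q" by simp
      from sum_digit_sum_lower[OF this] have "real q * real s - 2 ^ q \<le> 2 * N"
        by (simp add: N_def)
      moreover have "(0 :: real) < 2 ^ q" "0 \<le> real s" by simp_all
      ultimately show ?thesis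
        unfolding Suc power_Suc of_nat_Suc by (simp only: ring_distribs) argo
    qed
  next
    case False
    then have "real (2 ^ p) < real (2 * s)" by linarith
    then have "(2 :: real) ^ p < 2 * real s" by simp
    moreover have "real p * real s - 2 ^ p \<le> 2 * N"
      using sum_digit_sum_lower[OF \<open>s \<le> 2 ^ p\<close>] by (simp add: N_def)
    moreover have "(0 :: real) < 2 ^ p" by simp
    ultimately show ?thesis by (simp only: ring_distribs) argo
  qed
  moreover have "2 * (real m * (real (Suc p) / 2 - 1 + 1 / 8))
      = (2 ^ p + real s) / 4 + real p * 2 ^ p - 2 ^ p + (real p - 1) * real s"
    unfolding m_real by (simp add: field_simps)
  ultimately show ?thesis using sum_m by linarith
qed

theorem theorem3:
  shows "\<exists>c\<^sub>1::real. c\<^sub>1 > 0 \<and>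
    (\<forall>(n::nat) (\<A>::nat set set). n \<ge> 1 \<longrightarrow> \<A> \<subseteq> Pow {1..n} \<longrightarrow>
       union_closed_counterexample \<A> \<longrightarrow>
       (let \<B> = Pow {1..n} - \<A>; m = card \<B>
        in real (family_norm (colex_initial m)) > real m * (real n / 2 - 1 + c\<^sub>1)))"
proof (intro exI[of _ "1 / 8"] conjI allI impI)
  fix n :: nat and \<A> :: "nat set set"
  assume n: "n \<ge> 1" and sub: "\<A> \<subseteq> Pow {1..n}" and ce: "union_closed_counterexample \<A>"
  define m where "m = card (Pow {1..n} - \<A>)"
  obtain p where p: "n = Suc p" using n by (cases n) auto
  have uc: "union_closed \<A>"
    and deg: "\<And>i. i > 0 \<Longrightarrow> real (family_degree \<A> i) < real (card \<A>) / 2"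
    using ce by (auto simp: union_closed_counterexample_def)
  \<comment> \<open>In the full cube the element 1 has degree exactly half the size, against the
    strict inequality.\<close>
  have "\<A> \<noteq> Pow {1..n}"
  proof
    assume eq: "\<A> = Pow {1..n}"
    have "{A \<in> \<A>. 1 \<in> A} = insert 1 ` Pow {2..n}"
    proof (intro set_eqI iffI)
      fix A assume A: "A \<in> {A \<in> \<A>. 1 \<in> A}"
      have "{2..n} = {1..n} - {1}" by auto
      with A have "A - {1} \<in> Pow {2..n}" "A = insert 1 (A - {1})" unfolding eq by auto
      then show "A \<in> insert 1 ` Pow {2..n}" by blast
    qed (use n in \<open>auto simp: eq\<close>)
    moreover have "inj_on (insert 1) (Pow {2..n})"
      by (rule inj_onI) (auto dest!: insert_ident[THEN iffD1, rotated 2])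
    ultimately have "family_degree \<A> 1 = 2 ^ p"
      by (simp add: family_degree_def card_image card_Pow p)
    then show False
      using deg[of 1] by (simp add: eq card_Pow p)
  qed
  \<comment> \<open>Half the cube has \<open>2 ^ p\<close> members, so \<open>m\<close> lies in the
    dyadic range required by the digit-sum bound.\<close>
  then have "2 ^ n \<le> 2 * m"
    using counterexample_complement_large[OF _ sub uc] deg by (force simp: m_def less_imp_le)
  then have "2 ^ p \<le> m" by (simp add: p)
  moreover have "m \<le> 2 ^ Suc p"
    using card_mono[of "Pow {1..n}" "Pow {1..n} - \<A>"] by (simp add: m_def card_Pow p)
  ultimately have "real (\<Sum>j<m. digit_sum j) > real m * (real n / 2 - 1 + 1 / 8)"
    unfolding p by (rule sum_digit_sum_gt)
  then show "let \<B> = Pow {1..n} - \<A>; m = card \<B>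
      in real (family_norm (colex_initial m)) > real m * (real n / 2 - 1 + 1 / 8)"
    by (simp add: Let_def m_def family_norm_colex_initial)
qed simp

end
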